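(* Assume that $f'$ exists and is continuous in a neighborhood of $-\theta$, and that $h_n=cn^{-d}$ with $c>0$ and $\frac14<d<\frac12$. If the kernel $k$ is symmetric around the origin and $$0<\lim_{n\to\infty}V_\theta\Bigl[1-K\Bigl(-\frac{X_i}{h_n}\Bigr)\Bigr]<\infty,$$ then the standardized $\widetilde S$ is asymptotically normal: $$\frac{\widetilde S-E_\theta(\widetilde S)}{\sqrt{V_\theta(\widetilde S)}}\ \to\ N(0,1)\quad\text{in law as } n\to\infty.$$
   Context: $X_1,X_2,\dots,X_n$ are i.i.d. real random variables with distribution function $F(x-\theta)$, where $\theta\in\mathbb R$ is a fixed location parameter and $F$ has a density $f$ satisfying $f(-x)=f(x)$ for all $x$. $E_\theta$ and $V_\theta$ denote expectation and variance under this model. The kernel $k:\mathbb R\to\mathbb R$ satisfies $\int_{-\infty}^{\infty}k(u)\,du=1$ (it may take negative values), and is called symmetric (around the origin) if $k(-u)=k(u)$. Put $K(t)=\int_{-\infty}^t k(u)\,du$. The bandwidth $h_n>0$ satisfies $h_n\to0$ as $n\to\infty$. The smoothed sign statistic is $$\widetilde S=n-\sum_{i=1}^nK\Bigl(-\frac{X_i}{h_n}\Bigr).$$ *)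

theory Defs
  imports "HOL-Probability.Probability"
begin

definition integrated_kernel :: "(real \<Rightarrow> real) \<Rightarrow> real \<Rightarrow> real" where
  "integrated_kernel k t = (LBINT u:{..t}. k u)"

text \<open>The observations are indexed from 1, so \<open>X 0\<close> is never used.\<close>

definition smoothed_sign ::
  "(real \<Rightarrow> real) \<Rightarrow> (nat \<Rightarrow> real) \<Rightarrow> (nat \<Rightarrow> 'a \<Rightarrow> real) \<Rightarrow> nat \<Rightarrow> 'a \<Rightarrow> real" where
  "smoothed_sign k h X n \<omega> = real n - (\<Sum>i=1..n. integrated_kernel k (- X i \<omega> / h n))"

end

theory Submission
  imports Defs
begin

text \<open>
  The statistic is the sum \<open>\<Sum>i=1..n. (1 - K (- X i / h n))\<close>.  Its summands are independent and,
  for fixed \<open>n\<close>, identically distributed, but their law changes with \<open>n\<close> through the bandwidth;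
  the classical central limit theorem for a single sequence therefore has to be replaced by
  a version for triangular arrays.  Such a version is easy here because the summands are bounded
  uniformly in \<open>n\<close>: \<open>\<bar>K t\<bar> \<le> \<integral>\<bar>k\<bar>\<close>, since \<open>k\<close> is integrable (lemma \<open>abs_integrated_kernel_le\<close>).

  For a row-wise i.i.d. array bounded by \<open>C\<close> with row variances \<open>v n\<close>, a centred summand
  scaled by \<open>sqrt (n * v n)\<close> has variance \<open>1/n\<close> and third absolute moment at most
  \<open>(2 * C) ^ 3 / sqrt (n * v n) ^ 3\<close>.  A second-order Taylor expansion of its characteristic function
  therefore gives \<open>1 - t\<^sup>2 / (2 * n)\<close> up to an error of order \<open>n powr (-3/2)\<close>, provided that \<open>v n\<close>
  stays away from \<open>0\<close>.  Its \<open>n\<close>-th power, the characteristic function of the standardized sum,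
  tends to \<open>exp (- t\<^sup>2 / 2)\<close>, and Levy's continuity theorem turns this into convergence in law
  (theorem \<open>clt_bounded_iid_rows\<close>).  For the smoothed sign statistic the positive limit \<open>L\<close> of the
  variances keeps \<open>v n\<close> away from \<open>0\<close>.
\<close>

section \<open>A central limit theorem for bounded triangular arrays\<close>

text \<open>
  Square integrability of the sum is part of the claim because the induction step needs it to
  split off one more summand.
\<close>

lemma (in prob_space) variance_sum_indep_vars:
  fixes Y :: "'i \<Rightarrow> 'a \<Rightarrow> real"
  assumes "finite A"
    and indep: "indep_vars (\<lambda>_. borel) Y A"
    and sq: "\<And>i. i \<in> A \<Longrightarrow> integrable M (\<lambda>x. (Y i x)\<^sup>2)"
  shows "integrable M (\<lambda>x. (\<Sum>i\<in>A. Y i x)\<^sup>2) \<and>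
    variance (\<lambda>x. \<Sum>i\<in>A. Y i x) = (\<Sum>i\<in>A. variance (Y i))"
  using assms
proof (induction A rule: finite_induct)
  case empty
  then show ?case by simp
next
  case (insert a A)
  define S where "S x = (\<Sum>i\<in>A. Y i x)" for x
  have rv: "random_variable borel (Y i)" if "i \<in> insert a A" for i
    using insert.prems(1) that unfolding indep_vars_def2 by auto
  have [measurable]: "random_variable borel S" "random_variable borel (Y a)"
    unfolding S_def[abs_def] using rv by auto
  have "indep_vars (\<lambda>_. borel) Y A"
    using insert.prems(1) by (rule indep_vars_subset) auto
  then have S2: "integrable M (\<lambda>x. (S x)\<^sup>2)"
    and varS: "variance S = (\<Sum>i\<in>A. variance (Y i))"
    using insert.IH insert.prems(2) by (auto simp: S_def[abs_def])
  have Y2: "integrable M (\<lambda>x. (Y a x)\<^sup>2)"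
    using insert.prems(2) by simp
  have S1: "integrable M S" and Y1: "integrable M (Y a)"
    using S2 Y2 by (auto intro: square_integrable_imp_integrable)
  have ind: "indep_var borel (Y a) borel S"
    unfolding S_def[abs_def] using insert.hyps insert.prems(1) by (intro indep_vars_sum) auto
  have YS: "integrable M (\<lambda>x. Y a x * S x)"
    and EYS: "expectation (\<lambda>x. Y a x * S x) = expectation (Y a) * expectation S"
    using indep_var_integrable[OF ind Y1 S1] indep_var_lebesgue_integral[OF ind Y1 S1] by auto
  have sq_eq: "(Y a x + S x)\<^sup>2 = (Y a x)\<^sup>2 + (S x)\<^sup>2 + 2 * (Y a x * S x)" for x
    by (simp add: power2_eq_square algebra_simps)
  have int: "integrable M (\<lambda>x. (Y a x + S x)\<^sup>2)"
    unfolding sq_eq using Y2 S2 YS by simp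
  have "variance (\<lambda>x. Y a x + S x) =
      expectation (\<lambda>x. (Y a x + S x)\<^sup>2) - (expectation (\<lambda>x. Y a x + S x))\<^sup>2"
    using Y1 S1 int by (intro variance_eq) auto
  also have "\<dots> = variance (Y a) + variance S"
    using Y1 S1 Y2 S2 YS by (simp add: sq_eq variance_eq EYS) (simp add: power2_sum)
  finally have "variance (\<lambda>x. Y a x + S x) = variance (Y a) + variance S" .
  moreover have "(\<Sum>i\<in>insert a A. Y i x) = Y a x + S x" for x
    using insert.hyps by (simp add: S_def)
  moreover have "(\<Sum>i\<in>insert a A. variance (Y i)) = variance (Y a) + variance S"
    using insert.hyps varS by simp
  ultimately show ?case
    using int by (simp only: simp_thms)
qed

text \<open>
  The third moment of a centred variable bounded by \<open>C\<close> is at most \<open>C ^ 3\<close>, which makes the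
  remainder of the second-order expansion explicit.
\<close>

lemma (in prob_space) char_approx_bounded:
  fixes Z :: "'a \<Rightarrow> real"
  assumes rv [measurable]: "random_variable borel Z"
    and bound: "\<And>x. x \<in> space M \<Longrightarrow> \<bar>Z x\<bar> \<le> C"
    and mean: "expectation Z = 0"
  shows "cmod (char (distr M borel Z) s - (1 - s\<^sup>2 * variance Z / 2)) \<le> \<bar>s\<bar> ^ 3 * C ^ 3 / 6"
proof -
  have int: "integrable M Z"
    using bound by (intro integrable_const_bound[where B = C]) auto
  have int2: "integrable M (\<lambda>x. (Z x)\<^sup>2)"
  proof (intro integrable_const_bound[where B = "C\<^sup>2"])
    show "AE x in M. norm ((Z x)\<^sup>2) \<le> C\<^sup>2"
    proof (rule AE_I2)
      fix x assume "x \<in> space M"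
      then have "\<bar>Z x\<bar>\<^sup>2 \<le> C\<^sup>2"
        by (intro power_mono bound) auto
      then show "norm ((Z x)\<^sup>2) \<le> C\<^sup>2" by simp
    qed
  qed simp
  have "cmod (char (distr M borel Z) s - (1 - s\<^sup>2 * variance Z / 2)) \<le>
      s\<^sup>2 / 6 * expectation (\<lambda>x. min (6 * (Z x)\<^sup>2) (\<bar>s\<bar> * \<bar>Z x\<bar> ^ 3))"
    using int int2 mean by (intro char_approx3') auto
  also have "\<dots> \<le> s\<^sup>2 / 6 * (\<bar>s\<bar> * C ^ 3)"
  proof (intro mult_left_mono integral_le_const)
    show "integrable M (\<lambda>x. min (6 * (Z x)\<^sup>2) (\<bar>s\<bar> * \<bar>Z x\<bar> ^ 3))"
      by (rule Bochner_Integration.integrable_bound[where f = "\<lambda>x. 6 * (Z x)\<^sup>2"])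
         (use int2 in auto)
    show "AE x in M. min (6 * (Z x)\<^sup>2) (\<bar>s\<bar> * \<bar>Z x\<bar> ^ 3) \<le> \<bar>s\<bar> * C ^ 3"
      using bound by (intro AE_I2 min.coboundedI2 mult_left_mono power_mono) auto
  qed simp
  also have "\<dots> = \<bar>s\<bar> ^ 3 * C ^ 3 / 6"
    by (simp add: power3_eq_cube power2_eq_square)
  finally show ?thesis .
qed

text \<open>
  The uniform bound \<open>C\<close> together with \<open>L > 0\<close> makes Lyapunov's third-moment condition hold,
  whatever the laws \<open>\<mu> n\<close> of the rows are.
\<close>

theorem (in prob_space) clt_bounded_iid_rows:
  fixes Y :: "nat \<Rightarrow> nat \<Rightarrow> 'a \<Rightarrow> real"
  assumes indep: "\<And>n. indep_vars (\<lambda>_. borel) (Y n) {1..n}"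
    and law: "\<And>n i. i \<in> {1..n} \<Longrightarrow> distr M borel (Y n i) = \<mu> n"
    and bound: "\<And>n i x. i \<in> {1..n} \<Longrightarrow> x \<in> space M \<Longrightarrow> \<bar>Y n i x\<bar> \<le> C"
    and var: "\<And>n i. i \<in> {1..n} \<Longrightarrow> variance (Y n i) = v n"
    and lim: "v \<longlonglongrightarrow> L" and L: "0 < L"
  defines "S n x \<equiv> \<Sum>i=1..n. Y n i x"
  shows "weak_conv_m
    (\<lambda>n. distr M borel (\<lambda>x. (S n x - expectation (S n)) / sqrt (variance (S n))))
    std_normal_distribution"
proof (rule levy_continuity)
  have rv [measurable]: "random_variable borel (Y n i)" if "i \<in> {1..n}" for n i
    using indep[of n] that unfolding indep_vars_def2 by auto
  have rvS [measurable]: "random_variable borel (S n)" for n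
    unfolding S_def[abs_def] using rv by auto
  show "real_distribution
      (distr M borel (\<lambda>x. (S n x - expectation (S n)) / sqrt (variance (S n))))" for n
    by (rule real_distribution_distr) simp
  show "real_distribution std_normal_distribution"
    by (rule real_dist_normal_dist)
  have int: "integrable M (Y n i)" if "i \<in> {1..n}" for n i
    using bound[OF that] rv[OF that] by (intro integrable_const_bound[where B = C]) auto
  have int2: "integrable M (\<lambda>x. (Y n i x)\<^sup>2)" if "i \<in> {1..n}" for n i
  proof (intro integrable_const_bound[where B = "C\<^sup>2"])
    show "AE x in M. norm ((Y n i x)\<^sup>2) \<le> C\<^sup>2"
    proof (rule AE_I2)
      fix x assume "x \<in> space M"
      then have "\<bar>Y n i x\<bar>\<^sup>2 \<le> C\<^sup>2"
        by (intro power_mono bound that) auto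
      then show "norm ((Y n i x)\<^sup>2) \<le> C\<^sup>2" by simp
    qed
  qed (use rv[OF that] in simp)

  have varS: "variance (S n) = real n * v n" for n
    using variance_sum_indep_vars[OF _ indep int2, of n] var
    by (simp add: S_def[abs_def])

  define m where "m n = expectation (Y n 1)" for n
  have mean: "expectation (Y n i) = m n" if "i \<in> {1..n}" for n i
  proof -
    have 1: "1 \<in> {1..n}" using that by auto
    have "expectation (Y n i) = (\<integral>x. x \<partial>distr M borel (Y n i))"
      using rv[OF that] by (simp add: integral_distr)
    also have "\<dots> = (\<integral>x. x \<partial>distr M borel (Y n 1))"
      by (simp only: law[OF that] law[OF 1])
    also have "\<dots> = m n"
      using rv[OF 1] by (simp add: integral_distr m_def)
    finally show ?thesis .
  qed
  have meanS: "expectation (S n) = real n * m n" for n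
    unfolding S_def[abs_def] using int mean by (subst Bochner_Integration.integral_sum) auto

  define D where "D = C + C"
  have centred: "random_variable borel (\<lambda>x. Y n i x - m n)"
      "expectation (\<lambda>x. Y n i x - m n) = 0"
      "variance (\<lambda>x. Y n i x - m n) = v n"
      "\<And>x. x \<in> space M \<Longrightarrow> \<bar>Y n i x - m n\<bar> \<le> D"
    if i: "i \<in> {1..n}" for n i
  proof -
    show "random_variable borel (\<lambda>x. Y n i x - m n)"
      using rv[OF i] by simp
    show E0: "expectation (\<lambda>x. Y n i x - m n) = 0"
      using int[OF i] mean[OF i] by (simp add: prob_space)
    show "variance (\<lambda>x. Y n i x - m n) = v n"
      using E0 mean[OF i] var[OF i] by simp
    have "\<bar>m n\<bar> \<le> C"
    proof -
      have "\<bar>expectation (Y n i)\<bar> \<le> expectation (\<lambda>x. \<bar>Y n i x\<bar>)"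
        by (rule integral_abs_bound)
      also have "\<dots> \<le> C"
        using int[OF i] bound[OF i] by (intro integral_le_const) auto
      finally show ?thesis using mean[OF i] by simp
    qed
    then show "\<bar>Y n i x - m n\<bar> \<le> D" if "x \<in> space M" for x
      using bound[OF i that] by (auto simp: D_def)
  qed

  fix t :: real
  define \<phi> where
    "\<phi> n = char (distr M borel (\<lambda>x. (S n x - expectation (S n)) / sqrt (variance (S n)))) t" for n
  \<comment> \<open>The coefficient of \<open>1 / sqrt n\<close> is kept in terms of \<open>v n\<close> so that it converges, to a finite
    limit since \<open>L > 0\<close>.\<close>
  have main: "cmod (\<phi> n - complex_of_real ((1 + (- (t\<^sup>2) / 2) / n) ^ n)) \<le>
      \<bar>t\<bar> ^ 3 * D ^ 3 / (6 * (v n * sqrt (v n))) * (1 / sqrt (real n))"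
    if n: "n \<ge> 1" "real n \<ge> t\<^sup>2 / 4" and v: "v n > 0" for n
  proof -
    let ?s = "sqrt (real n * v n)"
    have n1: "1 \<in> {1..n}" using n by auto
    have s: "?s > 0" "?s\<^sup>2 = real n * v n" using n v by auto
    define \<psi> where "\<psi> = char (distr M borel (\<lambda>x. Y n 1 x - m n)) (t / ?s)"
    have factor: "char (distr M borel (\<lambda>x. (Y n i x - m n) / ?s)) t = \<psi>"
      if i: "i \<in> {1..n}" for i
    proof -
      have "char (distr M borel (\<lambda>x. (Y n j x - m n) / ?s)) t =
          (CLINT y|\<mu> n. iexp (t * ((y - m n) / ?s)))" if "j \<in> {1..n}" for j
        unfolding char_def law[OF that, symmetric] using rv[OF that]
        by (simp add: integral_distr)
      then have "char (distr M borel (\<lambda>x. (Y n i x - m n) / ?s)) t =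
          char (distr M borel (\<lambda>x. (Y n 1 x - m n) / ?s)) t"
        using i n1 by metis
      also have "\<dots> = \<psi>"
        unfolding \<psi>_def char_def using rv[OF n1] by (simp add: integral_distr)
      finally show ?thesis .
    qed
    have "(S n x - expectation (S n)) / sqrt (variance (S n)) = (\<Sum>i=1..n. (Y n i x - m n) / ?s)" for x
      unfolding varS unfolding meanS by (simp add: S_def sum_subtractf flip: sum_divide_distrib)
    then have "\<phi> n = char (distr M borel (\<lambda>x. \<Sum>i=1..n. (Y n i x - m n) / ?s)) t"
      by (simp add: \<phi>_def)
    also have "\<dots> = (\<Prod>i=1..n. char (distr M borel (\<lambda>x. (Y n i x - m n) / ?s)) t)"
      by (intro char_distr_sum
          indep_vars_compose2[OF indep, where Y = "\<lambda>i y. (y - m n) / ?s"]) auto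
    also have "\<dots> = \<psi> ^ n"
      using factor by simp
    finally have \<phi>_eq: "\<phi> n = \<psi> ^ n" .

    have "cmod (\<psi> - (1 - (t / ?s)\<^sup>2 * v n / 2)) \<le> \<bar>t / ?s\<bar> ^ 3 * D ^ 3 / 6"
      unfolding \<psi>_def centred(3)[OF n1, symmetric]
      using centred(1,2,4)[OF n1] by (intro char_approx_bounded) auto
    moreover have "1 - (t / ?s)\<^sup>2 * v n / 2 = 1 + (- (t\<^sup>2) / 2) / n"
      using v by (simp only: power_divide s(2)) simp
    ultimately have approx: "cmod (\<psi> - complex_of_real (1 + (- (t\<^sup>2) / 2) / n)) \<le> \<bar>t / ?s\<bar> ^ 3 * D ^ 3 / 6"
      by (simp only:)

    interpret Z: real_distribution "distr M borel (\<lambda>x. Y n 1 x - m n)"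
      using centred(1)[OF n1] by (rule real_distribution_distr)
    \<comment> \<open>Replacing \<open>\<psi>\<close> by its expansion in the \<open>n\<close>-th power costs only a factor \<open>n\<close> when both
      numbers lie in the unit disc; this is where \<open>n \<ge> t\<^sup>2 / 4\<close> enters.\<close>
    have "t\<^sup>2 / 2 / real n \<le> 2"
      using n by (simp add: field_simps)
    then have "\<bar>1 + (- (t\<^sup>2) / 2) / real n\<bar> \<le> 1"
      by (auto simp: abs_le_iff)
    then have "cmod (\<phi> n - complex_of_real (1 + (- (t\<^sup>2) / 2) / n) ^ n) \<le>
        n * cmod (\<psi> - complex_of_real (1 + (- (t\<^sup>2) / 2) / n))"
      unfolding \<phi>_eq
      by (intro norm_power_diff) (auto simp only: norm_of_real \<psi>_def Z.cmod_char_le_1)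
    also have "\<dots> \<le> n * (\<bar>t / ?s\<bar> ^ 3 * D ^ 3 / 6)"
      by (rule mult_left_mono[OF approx]) simp
    also have "?s ^ 3 = real n * v n * (sqrt n * sqrt (v n))"
      using s(2) by (simp add: power3_eq_cube power2_eq_square real_sqrt_mult)
    then have "n * (\<bar>t / ?s\<bar> ^ 3 * D ^ 3 / 6) =
        \<bar>t\<bar> ^ 3 * D ^ 3 / (6 * (v n * sqrt (v n))) * (1 / sqrt (real n))"
      using n(1) s(1) v by (simp add: abs_divide power_divide)
    finally show ?thesis by simp
  qed

  have "(\<lambda>n. \<bar>t\<bar> ^ 3 * D ^ 3 / (6 * (v n * sqrt (v n))) * (1 / sqrt (real n)))
      \<longlonglongrightarrow> \<bar>t\<bar> ^ 3 * D ^ 3 / (6 * (L * sqrt L)) * 0"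
    using L by (intro tendsto_intros lim)
      (auto intro!: tendsto_divide_0 filterlim_at_top_imp_at_infinity
        filterlim_compose[OF sqrt_at_top] filterlim_real_sequentially)
  then have remainder: "(\<lambda>n. \<bar>t\<bar> ^ 3 * D ^ 3 / (6 * (v n * sqrt (v n))) * (1 / sqrt (real n))) \<longlonglongrightarrow> 0"
    by simp
  have "eventually (\<lambda>n. v n > 0) sequentially"
    using lim L by (rule order_tendstoD)
  moreover have "eventually (\<lambda>n. real n \<ge> t\<^sup>2 / 4) sequentially"
    using filterlim_real_sequentially unfolding filterlim_at_top by blast
  ultimately have "eventually (\<lambda>n. cmod (\<phi> n - complex_of_real ((1 + (- (t\<^sup>2) / 2) / n) ^ n)) \<le>
      \<bar>t\<bar> ^ 3 * D ^ 3 / (6 * (v n * sqrt (v n))) * (1 / sqrt (real n))) sequentially"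
    using eventually_ge_at_top[of "1::nat"] by eventually_elim (rule main)
  then have diff: "(\<lambda>n. \<phi> n - complex_of_real ((1 + (- (t\<^sup>2) / 2) / n) ^ n)) \<longlonglongrightarrow> 0"
    using remainder by (rule Lim_null_comparison)
  have "(\<lambda>n. complex_of_real ((1 + (- (t\<^sup>2) / 2) / n) ^ n)) \<longlonglongrightarrow> complex_of_real (exp (- (t\<^sup>2) / 2))"
    by (rule isCont_tendsto_compose[OF _ tendsto_exp_limit_sequentially]) auto
  then have "\<phi> \<longlonglongrightarrow> complex_of_real (exp (- (t\<^sup>2) / 2))"
    using diff by (rule Lim_transform)
  then show "(\<lambda>n. char (distr M borel
      (\<lambda>x. (S n x - expectation (S n)) / sqrt (variance (S n)))) t)
    \<longlonglongrightarrow> char std_normal_distribution t"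
    by (simp add: \<phi>_def[abs_def] char_std_normal_distribution)
qed

section \<open>The integrated kernel\<close>

lemma abs_integrated_kernel_le:
  assumes "integrable lborel k"
  shows "\<bar>integrated_kernel k t\<bar> \<le> (LBINT u. \<bar>k u\<bar>)"
proof -
  have "\<bar>integrated_kernel k t\<bar> \<le> (LBINT u. \<bar>indicator {..t} u *\<^sub>R k u\<bar>)"
    unfolding integrated_kernel_def set_lebesgue_integral_def by (rule integral_abs_bound)
  also have "\<dots> \<le> (LBINT u. \<bar>k u\<bar>)"
    using assms
    by (intro integral_mono integrable_abs integrable_mult_indicator) (auto simp: indicator_def)
  finally show ?thesis .
qed

lemma borel_measurable_integrated_kernel:
  assumes "integrable lborel k"
  shows "integrated_kernel k \<in> borel_measurable borel"
proof -
  have [measurable]: "k \<in> borel_measurable borel"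
    using borel_measurable_integrable[OF assms] by simp
  \<comment> \<open>Writing the domain of integration as a condition on the pair \<open>(t, u)\<close> makes the integrand
    jointly measurable.\<close>
  have "integrated_kernel k = (\<lambda>t. LBINT u. (if u \<le> t then k u else 0))"
    unfolding integrated_kernel_def set_lebesgue_integral_def
    by (auto simp: fun_eq_iff indicator_def intro!: Bochner_Integration.integral_cong)
  also have "\<dots> \<in> borel_measurable borel"
    by measurable
  finally show ?thesis .
qed

section \<open>Asymptotic normality of the smoothed sign statistic\<close>

theorem theorem1:
  fixes M :: "'a measure"
    and X :: "nat \<Rightarrow> 'a \<Rightarrow> real"
    and F f k :: "real \<Rightarrow> real"
    and h :: "nat \<Rightarrow> real"
    and \<theta> c d L :: real
    and i :: nat
  assumes M: "prob_space M"
    and indep: "prob_space.indep_vars M (\<lambda>_. borel) X {1..}"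
    and law: "\<And>j x. j \<ge> 1 \<Longrightarrow> cdf (distr M borel (X j)) x = F (x - \<theta>)"
    and f_measurable: "f \<in> borel_measurable borel"
    and f_nonneg: "\<And>x. 0 \<le> f x"
    and f_prob: "prob_space (density lborel (\<lambda>x. ennreal (f x)))"
    and F_density: "\<And>x. F x = cdf (density lborel (\<lambda>x. ennreal (f x))) x"
    and f_symmetric: "\<And>x. f (- x) = f x"
    and f_deriv: "\<exists>U. open U \<and> - \<theta> \<in> U \<and> (\<forall>x\<in>U. f differentiable (at x)) \<and> continuous_on U (deriv f)"
    and k_integrable: "integrable lborel k"
    and k_integral: "(LBINT u. k u) = 1"
    and k_symmetric: "\<And>u. k (- u) = k u"
    and h: "\<And>n. n \<ge> 1 \<Longrightarrow> h n = c * real n powr (- d)"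
    and c: "c > 0"
    and d: "1 / 4 < d" "d < 1 / 2"
    and i: "i \<ge> 1"
    and variance_limit:
      "(\<lambda>n. prob_space.variance M (\<lambda>\<omega>. 1 - integrated_kernel k (- X i \<omega> / h n))) \<longlonglongrightarrow> L"
    and L: "0 < L"
  shows "weak_conv_m
    (\<lambda>n. distr M borel (\<lambda>\<omega>.
       (smoothed_sign k h X n \<omega> - prob_space.expectation M (smoothed_sign k h X n)) /
       sqrt (prob_space.variance M (smoothed_sign k h X n))))
    std_normal_distribution"
proof -
  interpret prob_space M by (rule M)
  define Y where "Y n j \<omega> = 1 - integrated_kernel k (- X j \<omega> / h n)" for n j \<omega>
  note [measurable] = borel_measurable_integrated_kernel[OF k_integrable]
  have rv: "random_variable borel (X j)" if "j \<ge> 1" for j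
    using indep that unfolding indep_vars_def2 by auto
  \<comment> \<open>The hypothesis on the variances concerns one index \<open>i\<close>; since all observations share the
    distribution function \<open>F (x - \<theta>)\<close>, it carries over to the whole row.\<close>
  have same_law: "distr M borel (X j) = distr M borel (X i)" if "j \<ge> 1" for j
    using rv[OF that] rv[OF i] law[OF that] law[OF i]
    by (intro cdf_unique real_distribution_distr) auto
  have g: "(\<lambda>y. 1 - integrated_kernel k (- y / h n)) \<in> borel_measurable borel" for n
    by measurable
  have law_Y: "distr M borel (Y n j) = distr M borel (Y n i)" if "j \<ge> 1" for n j
  proof -
    have "distr M borel (Y n l) =
        distr (distr M borel (X l)) borel (\<lambda>y. 1 - integrated_kernel k (- y / h n))"
      if "l \<ge> 1" for l
      using rv[OF that] g by (subst distr_distr) (auto simp: comp_def Y_def[abs_def])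
    then show ?thesis
      using same_law that i by metis
  qed
  have rv_Y: "random_variable borel (Y n j)" if "j \<ge> 1" for n j
    unfolding Y_def[abs_def] using rv[OF that] by measurable
  have var_Y: "variance (Y n j) = variance (Y n i)" if "j \<ge> 1" for n j
  proof -
    have E: "expectation (\<lambda>\<omega>. q (Y n l \<omega>)) = (\<integral>y. q y \<partial>distr M borel (Y n l))"
      if "l \<ge> 1" "q \<in> borel_measurable borel" for q :: "real \<Rightarrow> real" and l
      using rv_Y[OF that(1)] that(2) by (simp add: integral_distr)
    have "expectation (\<lambda>\<omega>. q (Y n j \<omega>)) = expectation (\<lambda>\<omega>. q (Y n i \<omega>))"
      if "q \<in> borel_measurable borel" for q :: "real \<Rightarrow> real"
      unfolding E[OF \<open>j \<ge> 1\<close> that] E[OF i that] law_Y[OF \<open>j \<ge> 1\<close>] ..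
    from this[of "\<lambda>y. y"] this[of "\<lambda>y. (y - expectation (Y n i))\<^sup>2"]
    show ?thesis by simp
  qed
  have indep_Y: "indep_vars (\<lambda>_. borel) (Y n) {1..n}" for n
    unfolding Y_def[abs_def]
    by (rule indep_vars_compose2[OF indep_vars_subset[OF indep]]) (auto intro: g)
  have bound_Y: "\<bar>Y n j \<omega>\<bar> \<le> 1 + (LBINT u. \<bar>k u\<bar>)" for n j \<omega>
    using abs_integrated_kernel_le[OF k_integrable, of "- X j \<omega> / h n"] by (auto simp: Y_def)
  have "smoothed_sign k h X n = (\<lambda>\<omega>. \<Sum>j=1..n. Y n j \<omega>)" for n
    by (simp add: fun_eq_iff smoothed_sign_def Y_def sum_subtractf)
  moreover have "weak_conv_m
    (\<lambda>n. distr M borel (\<lambda>\<omega>. ((\<Sum>j=1..n. Y n j \<omega>) - expectation (\<lambda>\<omega>. \<Sum>j=1..n. Y n j \<omega>)) /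
       sqrt (variance (\<lambda>\<omega>. \<Sum>j=1..n. Y n j \<omega>))))
    std_normal_distribution"
  proof (rule clt_bounded_iid_rows[where L = L])
    show "(\<lambda>n. variance (Y n i)) \<longlonglongrightarrow> L"
      using variance_limit by (simp add: Y_def[abs_def])
    show "distr M borel (Y n j) = distr M borel (Y n i)" if "j \<in> {1..n}" for n j
      using law_Y that by simp
    show "variance (Y n j) = variance (Y n i)" if "j \<in> {1..n}" for n j
      using var_Y that by simp
  qed (use indep_Y bound_Y L in auto)
  ultimately show ?thesis by simp
qed

end
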